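(* Let $r,m,n\ge 1$ be integers. Let $p_1,\dots,p_r$, $g_1,\dots,g_m$ and $q$ be real polynomials on $\mathbb{R}^n$ such that all $p_j$, all $g_i$ and $-q$ are SOS-convex, and such that $p_j(x)\ge 0$ (for all $j$) and $q(x)>0$ for all $x\in\mathcal F:=\{x\in\mathbb{R}^n : g_i(x)\le 0,\ i=1,\dots,m\}\neq\emptyset$. Let $d$ be the smallest even number such that $d\ge\max\{\deg q,\ \max_j\deg p_j,\ \max_i\deg g_i\}$. Consider $$(\mathcal P)\quad \inf_{x\in\mathcal F}\ \max_{1\le j\le r}\frac{p_j(x)}{q(x)}$$ and $$(\mathcal D)\quad \sup\Big\{\mu : \sum_{j=1}^r\delta_jp_j+\sum_{i=1}^m\lambda_ig_i-\mu q\in\Sigma^2_d,\ \delta\in\Delta,\ \lambda\in\mathbb{R}^m_+,\ \mu\in\mathbb{R}\Big\}.$$ Let $x^*\in\mathcal F$ be an optimal solution of $(\mathcal P)$ and assume that the normal cone condition for $\mathcal F$ holds at $x^*$. Then $\min(\mathcal P)=\max(\mathcal D)$; that is, the optimal values are equal and both are attained.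
   Context: $\mathbb{R}^k_+$ denotes the set of vectors in $\mathbb{R}^k$ with nonnegative coordinates, and $\Delta:=\{\delta\in\mathbb{R}^r_+ : \sum_{j=1}^r\delta_j=1\}$. A real polynomial $f$ on $\mathbb{R}^n$ is a sum of squares if it is a finite sum of squares of real polynomials; $\Sigma^2_d$ is the set of sum of squares real polynomials on $\mathbb{R}^n$ of degree at most $d$. A real polynomial $f$ on $\mathbb{R}^n$ is SOS-convex if its Hessian is an SOS-matrix polynomial, i.e. $\nabla^2 f(x)=H(x)H(x)^T$ for some $s\in\mathbb{N}$ and some matrix polynomial $H\in\mathbb{R}[x]^{n\times s}$. For a convex set $C\subset\mathbb{R}^n$ and $x\in C$, the normal cone is $N_C(x):=\{v\in\mathbb{R}^n : v^T(y-x)\le 0\ \forall y\in C\}$. The normal cone condition holds for $\mathcal F$ at $x\in\mathcal F$ if $N_{\mathcal F}(x)=\{\sum_{i=1}^m\lambda_i\nabla g_i(x) : \lambda\in\mathbb{R}^m_+,\ \sum_{i=1}^m\lambda_ig_i(x)=0\}$. *)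

theory Defs
  imports "HOL-Analysis.Analysis"
begin

text \<open>
  Real polynomials on $R^n$ are identified with the polynomial functions they induce
  (\<^const>\<open>real_polynomial_function\<close>); over the reals the identification is one-to-one.
\<close>

text \<open>
  Total degree. A multi-index is a function \<open>\<alpha> :: 'n \<Rightarrow> nat\<close>. The zero polynomial has degree \<open>0\<close>.
  Only meaningful for polynomial functions.
\<close>

definition poly_degree :: "(real^'n \<Rightarrow> real) \<Rightarrow> nat" where
  "poly_degree f = (LEAST d. \<exists>c :: ('n \<Rightarrow> nat) \<Rightarrow> real.
     \<forall>x. f x = (\<Sum>\<alpha> | (\<Sum>i\<in>UNIV. \<alpha> i) \<le> d. c \<alpha> * (\<Prod>i\<in>UNIV. (x $ i) ^ \<alpha> i)))"

definition gradient :: "(real^'n \<Rightarrow> real) \<Rightarrow> real^'n \<Rightarrow> real^'n" where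
  "gradient f x = (\<chi> i. frechet_derivative f (at x) (axis i 1))"

definition hessian :: "(real^'n \<Rightarrow> real) \<Rightarrow> real^'n \<Rightarrow> real^'n^'n" where
  "hessian f x = matrix (frechet_derivative (gradient f) (at x))"

definition sum_of_squares :: "(real^'n \<Rightarrow> real) \<Rightarrow> bool" where
  "sum_of_squares f \<longleftrightarrow> (\<exists>(k::nat) h. (\<forall>i<k. real_polynomial_function (h i)) \<and>
     (\<forall>x. f x = (\<Sum>i<k. (h i x)\<^sup>2)))"

definition sos_of_degree_at_most :: "nat \<Rightarrow> (real^'n \<Rightarrow> real) set" where
  "sos_of_degree_at_most d = {f. sum_of_squares f \<and> poly_degree f \<le> d}"

text \<open>
  \<open>M = H H\<^sup>T\<close> for an \<open>n \<times> s\<close> matrix polynomial \<open>H\<close>. As \<open>s\<close> is existentially quantified, \<open>H\<close> is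
  given by its entries \<open>H i k\<close> with column index \<open>k < s\<close>.
\<close>

definition sos_matrix_polynomial :: "(real^'n \<Rightarrow> real^'n^'n) \<Rightarrow> bool" where
  "sos_matrix_polynomial M \<longleftrightarrow> (\<exists>(s::nat) (H :: 'n \<Rightarrow> nat \<Rightarrow> real^'n \<Rightarrow> real).
     (\<forall>i. \<forall>k<s. real_polynomial_function (H i k)) \<and>
     (\<forall>x. M x = (\<chi> i j. \<Sum>k<s. H i k x * H j k x)))"

definition sos_convex :: "(real^'n \<Rightarrow> real) \<Rightarrow> bool" where
  "sos_convex f \<longleftrightarrow> real_polynomial_function f \<and> sos_matrix_polynomial (hessian f)"

definition nonneg_orthant :: "(real^'k) set" where
  "nonneg_orthant = {v. \<forall>i. 0 \<le> v $ i}"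

definition unit_simplex :: "(real^'k) set" where
  "unit_simplex = {\<delta> \<in> nonneg_orthant. (\<Sum>j\<in>UNIV. \<delta> $ j) = 1}"

definition normal_cone :: "(real^'n) set \<Rightarrow> real^'n \<Rightarrow> (real^'n) set" where
  "normal_cone C x = {v. \<forall>y\<in>C. v \<bullet> (y - x) \<le> 0}"

definition feasible_set :: "('m \<Rightarrow> real^'n \<Rightarrow> real) \<Rightarrow> (real^'n) set" where
  "feasible_set g = {x. \<forall>i. g i x \<le> 0}"

definition normal_cone_condition :: "('m::finite \<Rightarrow> real^'n \<Rightarrow> real) \<Rightarrow> real^'n \<Rightarrow> bool" where
  "normal_cone_condition g x \<longleftrightarrow>
     normal_cone (feasible_set g) x =
       {\<Sum>i\<in>UNIV. (l $ i) *\<^sub>R gradient (g i) x | l :: real^'m.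
          l \<in> nonneg_orthant \<and> (\<Sum>i\<in>UNIV. (l $ i) * g i x) = 0}"

definition primal_objective ::
  "('r::finite \<Rightarrow> real^'n \<Rightarrow> real) \<Rightarrow> (real^'n \<Rightarrow> real) \<Rightarrow> real^'n \<Rightarrow> real" where
  "primal_objective p q x = (MAX j. p j x / q x)"

definition dual_feasible_values ::
  "nat \<Rightarrow> ('r::finite \<Rightarrow> real^'n \<Rightarrow> real) \<Rightarrow> ('m::finite \<Rightarrow> real^'n \<Rightarrow> real) \<Rightarrow>
   (real^'n \<Rightarrow> real) \<Rightarrow> real set" where
  "dual_feasible_values d p g q =
     {\<mu>. \<exists>\<delta> \<in> (unit_simplex :: (real^'r) set). \<exists>l \<in> (nonneg_orthant :: (real^'m) set).
        (\<lambda>x. (\<Sum>j\<in>UNIV. (\<delta> $ j) * p j x) + (\<Sum>i\<in>UNIV. (l $ i) * g i x) - \<mu> * q x)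
          \<in> sos_of_degree_at_most d}"

text \<open>
  Optimal values are taken in the extended reals, so that no boundedness or nonemptiness
  assumption is hidden in \<open>Inf\<close> and \<open>Sup\<close>.
\<close>

definition primal_value ::
  "('r::finite \<Rightarrow> real^'n \<Rightarrow> real) \<Rightarrow> ('m \<Rightarrow> real^'n \<Rightarrow> real) \<Rightarrow>
   (real^'n \<Rightarrow> real) \<Rightarrow> ereal" where
  "primal_value p g q = (INF x\<in>feasible_set g. ereal (primal_objective p q x))"

definition dual_value ::
  "nat \<Rightarrow> ('r::finite \<Rightarrow> real^'n \<Rightarrow> real) \<Rightarrow> ('m::finite \<Rightarrow> real^'n \<Rightarrow> real) \<Rightarrow>
   (real^'n \<Rightarrow> real) \<Rightarrow> ereal" where
  "dual_value d p g q = (SUP \<mu>\<in>dual_feasible_values d p g q. ereal \<mu>)"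

end

theory Submission
  imports Defs
begin

text \<open>
  Let \<open>\<mu>\<close> be the optimal value of the primal problem. The functions \<open>p j - \<mu> q\<close> are convex and have
  no common negative value on the feasible set, so a separation argument yields weights \<open>\<delta>\<close> for
  which \<open>\<phi> = \<Sum>\<delta>\<^sub>j p\<^sub>j - \<mu> q\<close> is nonnegative there, with minimum \<open>0\<close> at the optimal point. The
  normal cone condition then supplies multipliers \<open>\<lambda>\<close> such that \<open>\<sigma> = \<phi> + \<Sum>\<lambda>\<^sub>i g\<^sub>i\<close> vanishes at
  that point together with its gradient, so \<open>\<sigma>\<close> is a nonnegative combination of the Bregman
  remainders \<open>f x - f a - \<nabla>f(a) \<bullet> (x - a)\<close> of the data. For SOS-convex \<open>f\<close> this remainder is the
  double integral of the Hessian form along the segment from \<open>a\<close> to \<open>x\<close>. The integrand is a sum of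
  squares of polynomials in the segment parameter, and integrating such a square gives a positive
  semidefinite quadratic form in its coefficients, hence a sum of squares of polynomials in \<open>x\<close>.
\<close>

section \<open>Positive semidefinite forms as sums of squares of linear forms\<close>

text \<open>Induction on \<open>n\<close>, each step being one of a Cholesky factorisation: the
  square completed in the last variable is the new summand, and the Schur complement left over in
  the first \<open>n\<close> variables is again positive semidefinite. \<open>L\<close> does not
  depend on \<open>u\<close>, so polynomials can later be substituted for the variables.\<close>

lemma psd_quadratic_form_sum_of_squares:
  fixes M :: "nat \<Rightarrow> nat \<Rightarrow> real"
  assumes "\<And>a b. M a b = M b a"
    and "\<And>u. 0 \<le> (\<Sum>a<n. \<Sum>b<n. M a b * u a * u b)"
  shows "\<exists>L. \<forall>u. (\<Sum>a<n. \<Sum>b<n. M a b * u a * u b) = (\<Sum>k<n. (\<Sum>a<n. L k a * u a)\<^sup>2)"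
  using assms
proof (induction n arbitrary: M)
  case 0
  then show ?case by simp
next
  case (Suc n)
  note sym = Suc.prems(1) and psd = Suc.prems(2)
  define S where "S u = (\<Sum>a<n. M a n * u a)" for u
  define Q where "Q u = (\<Sum>a<n. \<Sum>b<n. M a b * u a * u b)" for u
  have split: "(\<Sum>a<Suc n. \<Sum>b<Suc n. M a b * u a * u b)
      = Q u + 2 * u n * S u + M n n * (u n)\<^sup>2" for u
  proof -
    have "(\<Sum>b<n. M n b * u n * u b) = u n * S u"
      unfolding S_def sum_distrib_left by (intro sum.cong) (auto simp: sym[of n])
    moreover have "(\<Sum>a<n. M a n * u a * u n) = u n * S u"
      unfolding S_def sum_distrib_left by (intro sum.cong) auto
    ultimately show ?thesis
      by (simp add: sum.distrib Q_def power2_eq_square)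
  qed
  have upd: "Q (u(n := t)) = Q u" "S (u(n := t)) = S u" for u t
    by (auto simp: Q_def S_def)
  have ineq: "0 \<le> Q u + 2 * t * S u + M n n * t\<^sup>2" for u t
    using psd[of "u(n := t)"] unfolding split upd by simp
  \<comment> \<open>Completing the square in the last variable; for \<open>M n n = 0\<close> the Schur complement
    degenerates to \<open>M\<close>, since \<open>x / 0 = 0\<close>.\<close>
  define M' where "M' a b = M a b - M a n * M b n / M n n" for a b
  have M'Q: "(\<Sum>a<n. \<Sum>b<n. M' a b * u a * u b) = Q u - (S u)\<^sup>2 / M n n" for u
  proof -
    have "(S u)\<^sup>2 / M n n = (\<Sum>a<n. \<Sum>b<n. M a n * M b n / M n n * u a * u b)"
      unfolding S_def power2_eq_square sum_product sum_divide_distrib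
      by (intro sum.cong) (auto simp: field_simps)
    then show ?thesis
      by (simp add: M'_def Q_def left_diff_distrib sum_subtractf)
  qed
  have M'psd: "0 \<le> (\<Sum>a<n. \<Sum>b<n. M' a b * u a * u b)" for u
  proof (cases "M n n = 0")
    case True
    then show ?thesis using ineq[of u 0] unfolding M'Q by simp
  next
    case False
    \<comment> \<open>This value of the last variable minimises the form, and the minimum is the
      Schur complement.\<close>
    then show ?thesis using ineq[of u "- S u / M n n"] unfolding M'Q
      by (simp add: power2_eq_square field_simps)
  qed
  have "M' a b = M' b a" for a b
    by (simp add: M'_def sym[of a b] mult.commute)
  from Suc.IH[OF this M'psd] obtain L where
    L: "\<And>u. Q u - (S u)\<^sup>2 / M n n = (\<Sum>k<n. (\<Sum>a<n. L k a * u a)\<^sup>2)"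
    unfolding M'Q by blast
  have nonneg: "0 \<le> M n n"
    using ineq[of "\<lambda>_. 0" 1] by (simp add: Q_def S_def)
  have S0: "S u = 0" if "M n n = 0" for u
  proof (rule ccontr)
    assume "S u \<noteq> 0"
    \<comment> \<open>With \<open>M n n = 0\<close> the form is affine in the last variable; at this
      value it would equal -1.\<close>
    then show False using ineq[of u "- (Q u + 1) / (2 * S u)"] that by (simp add: field_simps)
  qed
  have square: "2 * u n * S u + M n n * (u n)\<^sup>2 + (S u)\<^sup>2 / M n n
      = (S u / sqrt (M n n) + sqrt (M n n) * u n)\<^sup>2" for u
  proof (cases "M n n = 0")
    case True
    then show ?thesis using S0 by simp
  next
    case False
    then show ?thesis using nonneg
      by (simp add: power2_sum power_divide power_mult_distrib)
  qed
  \<comment> \<open>The old rows get a zero coefficient for the last variable; row \<open>n\<close>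
    is the completed square. If \<open>M n n = 0\<close>, row \<open>n\<close> is zero, again by
    \<open>x / 0 = 0\<close>.\<close>
  define L' where "L' k a = (if k < n then (if a < n then L k a else 0)
    else if a < n then M a n / sqrt (M n n) else sqrt (M n n))" for k a
  have "(\<Sum>a<Suc n. \<Sum>b<Suc n. M a b * u a * u b) = (\<Sum>k<Suc n. (\<Sum>a<Suc n. L' k a * u a)\<^sup>2)" for u
  proof -
    have "S u / sqrt (M n n) = (\<Sum>a<n. L' n a * u a)"
      unfolding S_def sum_divide_distrib by (intro sum.cong) (auto simp: L'_def)
    moreover have "(\<Sum>k<n. (\<Sum>a<n. L k a * u a)\<^sup>2) = (\<Sum>k<n. (\<Sum>a<Suc n. L' k a * u a)\<^sup>2)"
    proof (rule sum.cong[OF refl])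
      fix k assume "k \<in> {..<n}"
      then have "(\<Sum>a<n. L k a * u a) = (\<Sum>a<Suc n. L' k a * u a)"
        by (simp add: L'_def)
      then show "(\<Sum>a<n. L k a * u a)\<^sup>2 = (\<Sum>a<Suc n. L' k a * u a)\<^sup>2"
        by simp
    qed
    ultimately show ?thesis
      unfolding split using L[of u] square[of u] by (simp add: L'_def)
  qed
  then show ?case by blast
qed

section \<open>The convex cone of sums of squares\<close>

lemma sum_of_squares_0: "sum_of_squares (\<lambda>x. 0)"
  unfolding sum_of_squares_def by (rule exI[of _ 0]) simp

lemma sum_of_squares_add_square:
  assumes "sum_of_squares f" "real_polynomial_function w"
  shows "sum_of_squares (\<lambda>x. f x + (w x)\<^sup>2)"
proof -
  from assms(1) obtain k :: nat and h where h: "\<And>i. i < k \<Longrightarrow> real_polynomial_function (h i)"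
    "\<And>x. f x = (\<Sum>i<k. (h i x)\<^sup>2)"
    unfolding sum_of_squares_def by blast
  have "f x + (w x)\<^sup>2 = (\<Sum>i<Suc k. ((h(k := w)) i x)\<^sup>2)" for x
    by (simp add: h(2))
  moreover have "\<forall>i<Suc k. real_polynomial_function ((h(k := w)) i)"
    using h(1) assms(2) by (auto simp: less_Suc_eq)
  ultimately show ?thesis
    unfolding sum_of_squares_def by blast
qed

lemma sum_of_squares_add:
  assumes f: "sum_of_squares f" and "sum_of_squares g"
  shows "sum_of_squares (\<lambda>x. f x + g x)"
proof -
  from assms(2) obtain l :: nat and h where h: "\<And>i. i < l \<Longrightarrow> real_polynomial_function (h i)"
    "\<And>x. g x = (\<Sum>i<l. (h i x)\<^sup>2)"
    unfolding sum_of_squares_def by blast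
  have "sum_of_squares (\<lambda>x. f x + (\<Sum>i<j. (h i x)\<^sup>2))" if "j \<le> l" for j
    using that
  proof (induction j)
    case 0
    then show ?case using f by simp
  next
    case (Suc j)
    then show ?case
      using sum_of_squares_add_square[of "\<lambda>x. f x + (\<Sum>i<j. (h i x)\<^sup>2)" "h j"] h(1)
      by (simp add: add.assoc)
  qed
  from this[of l] show ?thesis by (simp add: h(2))
qed

lemma sum_of_squares_sum:
  assumes "finite I" "\<And>i. i \<in> I \<Longrightarrow> sum_of_squares (f i)"
  shows "sum_of_squares (\<lambda>x. \<Sum>i\<in>I. f i x)"
  using assms by (induction I) (auto simp: sum_of_squares_0 intro: sum_of_squares_add)

lemma sum_of_squares_scale:
  assumes "sum_of_squares f" "0 \<le> c"
  shows "sum_of_squares (\<lambda>x. c * f x)"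
proof -
  from assms(1) obtain k :: nat and h where h: "\<And>i. i < k \<Longrightarrow> real_polynomial_function (h i)"
    "\<And>x. f x = (\<Sum>i<k. (h i x)\<^sup>2)"
    unfolding sum_of_squares_def by blast
  have "c * f x = (\<Sum>i<k. (sqrt c * h i x)\<^sup>2)" for x
    using assms(2) by (simp add: h(2) sum_distrib_left power_mult_distrib)
  moreover have "\<forall>i<k. real_polynomial_function (\<lambda>x. sqrt c * h i x)"
    using h(1) by auto
  ultimately show ?thesis
    unfolding sum_of_squares_def by (intro exI[of _ k] exI[of _ "\<lambda>i x. sqrt c * h i x"]) blast
qed

lemma sum_of_squares_nonneg: "sum_of_squares f \<Longrightarrow> 0 \<le> f x"
  unfolding sum_of_squares_def by (auto intro!: sum_nonneg)

section \<open>Polynomials in a segment parameter\<close>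

text \<open>Elements of R[x][t], with \<open>u b\<close> the coefficient of \<open>t ^ b\<close>.
  Demanding zero coefficients beyond \<open>N\<close> lets families be padded to a common length and
  multiplied by the Cauchy product.\<close>

definition polynomial_family :: "(real \<Rightarrow> 'a::real_normed_vector \<Rightarrow> real) \<Rightarrow> bool" where
  "polynomial_family F \<longleftrightarrow> (\<exists>N u. (\<forall>b. real_polynomial_function (u b)) \<and> (\<forall>b>N. u b = (\<lambda>x. 0)) \<and>
     (\<forall>t x. F t x = (\<Sum>b\<le>(N::nat). u b x * t ^ b)))"

lemma polynomial_family_const:
  assumes "real_polynomial_function f"
  shows "polynomial_family (\<lambda>t. f)"
  unfolding polynomial_family_def
  by (rule exI[of _ 0], rule exI[of _ "\<lambda>b. if b = 0 then f else (\<lambda>x. 0)"])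
     (use assms in auto)

lemma polynomial_family_param: "polynomial_family (\<lambda>t x. t)"
  unfolding polynomial_family_def
  by (rule exI[of _ 1], rule exI[of _ "\<lambda>b. if b = 1 then (\<lambda>x. 1) else (\<lambda>x. 0)"]) auto

lemma polynomial_family_add:
  assumes "polynomial_family F" "polynomial_family G"
  shows "polynomial_family (\<lambda>t x. F t x + G t x)"
proof -
  from assms(1) obtain M u where u: "\<And>b. real_polynomial_function (u b)"
    "\<And>b. b > M \<Longrightarrow> u b = (\<lambda>x. 0)" "\<And>t x. F t x = (\<Sum>b\<le>M. u b x * t ^ b)"
    unfolding polynomial_family_def by blast
  from assms(2) obtain N v where v: "\<And>b. real_polynomial_function (v b)"
    "\<And>b. b > N \<Longrightarrow> v b = (\<lambda>x. 0)" "\<And>t x. G t x = (\<Sum>b\<le>N. v b x * t ^ b)"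
    unfolding polynomial_family_def by blast
  have "F t x = (\<Sum>b\<le>M+N. u b x * t ^ b)" for t x
    unfolding u(3) by (rule sum.mono_neutral_left) (auto simp: u(2))
  moreover have "G t x = (\<Sum>b\<le>M+N. v b x * t ^ b)" for t x
    unfolding v(3) by (rule sum.mono_neutral_left) (auto simp: v(2))
  ultimately have "F t x + G t x = (\<Sum>b\<le>M+N. (u b x + v b x) * t ^ b)" for t x
    by (simp add: sum.distrib distrib_right)
  then show ?thesis
    unfolding polynomial_family_def
    by (intro exI[of _ "M+N"] exI[of _ "\<lambda>b x. u b x + v b x"]) (auto simp: u v)
qed

lemma polynomial_family_mult:
  assumes "polynomial_family F" "polynomial_family G"
  shows "polynomial_family (\<lambda>t x. F t x * G t x)"
proof -
  from assms(1) obtain M u where u: "\<And>b. real_polynomial_function (u b)"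
    "\<And>b. b > M \<Longrightarrow> u b = (\<lambda>x. 0)" "\<And>t x. F t x = (\<Sum>b\<le>M. u b x * t ^ b)"
    unfolding polynomial_family_def by blast
  from assms(2) obtain N v where v: "\<And>b. real_polynomial_function (v b)"
    "\<And>b. b > N \<Longrightarrow> v b = (\<lambda>x. 0)" "\<And>t x. G t x = (\<Sum>b\<le>N. v b x * t ^ b)"
    unfolding polynomial_family_def by blast
  have *: "u b x * v (c - b) x = 0" if "c > M + N" "b \<le> c" for b c x
    using that u(2)[of b] v(2)[of "c - b"] by (cases "b > M") auto
  have "F t x * G t x = (\<Sum>c\<le>M+N. (\<Sum>b\<le>c. u b x * v (c - b) x) * t ^ c)" for t x
    unfolding u(3) v(3) by (rule polynomial_product) (auto simp: u v)
  then show ?thesis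
    unfolding polynomial_family_def
    by (intro exI[of _ "M+N"] exI[of _ "\<lambda>c x. \<Sum>b\<le>c. u b x * v (c - b) x"])
       (intro conjI allI impI real_polynomial_function_sum real_polynomial_function.intros(4) u(1) v(1);
        auto simp: * intro!: sum.neutral)
qed

lemma polynomial_family_sum:
  assumes "finite I" "\<And>i. i \<in> I \<Longrightarrow> polynomial_family (F i)"
  shows "polynomial_family (\<lambda>t x. \<Sum>i\<in>I. F i t x)"
  using assms
  by (induction I) (auto intro: polynomial_family_add polynomial_family_const)

lemma polynomial_family_segment:
  assumes "real_polynomial_function f"
  shows "polynomial_family (\<lambda>t x. f (a + t *\<^sub>R (x - a)))"
  using assms
proof (induction f)
  case (linear f)
  interpret bounded_linear f by fact
  have "real_polynomial_function f"
    by (rule real_polynomial_function.intros(1)) fact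
  \<comment> \<open>Along the segment a linear form is affine in \<open>t\<close>.\<close>
  have "polynomial_family (\<lambda>t x. f a + t * (f x - f a))"
    by (intro polynomial_family_add polynomial_family_mult polynomial_family_param
        polynomial_family_const) (use \<open>real_polynomial_function f\<close> in auto)
  then show ?case by (simp add: add diff scale)
qed (auto intro: polynomial_family_const polynomial_family_add polynomial_family_mult)

section \<open>Double integrals of squares\<close>

text \<open>For continuous \<open>\<phi>\<close>, \<open>P 1\<close> is the Taylor remainder, the
  integral of \<open>(1 - t) * \<phi> t\<close> over [0,1]. Stated through derivatives, it can be
  compared with other functions by the constancy of functions with zero derivative.\<close>

definition double_antiderivative :: "(real \<Rightarrow> real) \<Rightarrow> (real \<Rightarrow> real) \<Rightarrow> (real \<Rightarrow> real) \<Rightarrow> bool" where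
  "double_antiderivative \<phi> P P' \<longleftrightarrow> P 0 = 0 \<and> P' 0 = 0 \<and>
    (\<forall>t. (P has_real_derivative P' t) (at t) \<and> (P' has_real_derivative \<phi> t) (at t))"

text \<open>The double integral of the square is a quadratic form in the coefficients
  \<open>u b x\<close>, with a constant matrix. The form is nonnegative for all real coefficients
  because a square is integrated, so it splits into squares of linear forms in the
  \<open>u b x\<close>, which are polynomials in \<open>x\<close>. One \<open>S\<close> serves every
  \<open>x\<close>.\<close>

lemma double_antiderivative_square_sos:
  fixes F :: "real \<Rightarrow> real^'n \<Rightarrow> real"
  assumes "polynomial_family F"
  shows "\<exists>S. sum_of_squares S \<and> (\<forall>x. \<exists>P P'. double_antiderivative (\<lambda>t. (F t x)\<^sup>2) P P' \<and> P 1 = S x)"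
proof -
  from assms obtain N :: nat and u where u: "\<And>b. real_polynomial_function (u b)"
    "\<And>t x. F t x = (\<Sum>b\<le>N. u b x * t ^ b)"
    unfolding polynomial_family_def by blast
  define n where "n = Suc N"
  have F: "F t x = (\<Sum>b<n. u b x * t ^ b)" for t x
    unfolding u(2) n_def lessThan_Suc_atMost ..
  \<comment> \<open>Integrating \<open>t ^ (b + c)\<close> twice from 0 and evaluating at 1 gives
    this factor.\<close>
  define M where "M b c = 1 / (real (b + c + 1) * real (b + c + 2))" for b c :: nat
  define P where "P w t = (\<Sum>b<n. \<Sum>c<n. M b c * w b * w c * t ^ (b + c + 2))" for w t
  define P' where "P' w t = (\<Sum>b<n. \<Sum>c<n. w b * w c / real (b + c + 1) * t ^ (b + c + 1))" for w t
  have dP: "(P w has_real_derivative P' w t) (at t)" for w t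
    unfolding P_def P'_def M_def
    by (rule derivative_eq_intros refl)+
       (auto intro!: sum.cong simp: divide_simps)
  have dP': "(P' w has_real_derivative (\<Sum>b<n. w b * t ^ b)\<^sup>2) (at t)" for w t
    unfolding P'_def power2_eq_square sum_product
    by (rule derivative_eq_intros refl)+
       (auto intro!: sum.cong simp: divide_simps power_add)
  have zero: "P w 0 = 0" "P' w 0 = 0" for w
    by (simp_all add: P_def P'_def)
  \<comment> \<open>Monotonicity is used twice: \<open>P' w\<close> starts at 0 with a square as
    derivative, and \<open>P w\<close> starts at 0 with derivative \<open>P' w\<close>.\<close>
  have "0 \<le> P' w t" if "0 \<le> t" for w t
    using DERIV_nonneg_imp_nondecreasing[OF that, of "P' w"] dP' zero(2) by (metis zero_le_power2)
  then have "0 \<le> P w 1" for w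
    using DERIV_nonneg_imp_nondecreasing[of 0 1 "P w"] dP zero(1) by (metis zero_le_one)
  moreover have P1: "P w 1 = (\<Sum>b<n. \<Sum>c<n. M b c * w b * w c)" for w
    by (simp add: P_def)
  ultimately have "0 \<le> (\<Sum>b<n. \<Sum>c<n. M b c * w b * w c)" for w
    by metis
  moreover have "M b c = M c b" for b c
    by (simp add: M_def add.commute)
  ultimately obtain L where
    L: "\<And>w. (\<Sum>b<n. \<Sum>c<n. M b c * w b * w c) = (\<Sum>k<n. (\<Sum>b<n. L k b * w b)\<^sup>2)"
    using psd_quadratic_form_sum_of_squares by blast
  define S where "S x = (\<Sum>k<n. (\<Sum>b<n. L k b * u b x)\<^sup>2)" for x
  have "sum_of_squares S"
    unfolding sum_of_squares_def S_def
    by (intro exI[of _ n] exI[of _ "\<lambda>k x. \<Sum>b<n. L k b * u b x"] conjI allI impI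
        real_polynomial_function_sum real_polynomial_function.intros(4) u(1)) auto
  moreover have "double_antiderivative (\<lambda>t. (F t x)\<^sup>2) (P (\<lambda>b. u b x)) (P' (\<lambda>b. u b x))" for x
    unfolding double_antiderivative_def F using dP dP' zero by simp
  moreover have "P (\<lambda>b. u b x) 1 = S x" for x
    unfolding P1 L S_def ..
  ultimately show ?thesis by blast
qed

section \<open>Gradients and Hessians of polynomials\<close>

text \<open>The existential form suits induction over polynomial functions, where the sum and
  product rules build \<open>G\<close>; uniqueness of derivatives then identifies \<open>G\<close>
  with \<open>gradient f\<close>.\<close>

lemma real_polynomial_function_has_polynomial_gradient:
  fixes f :: "real^'n \<Rightarrow> real"
  assumes "real_polynomial_function f"
  shows "\<exists>G. (\<forall>i. real_polynomial_function (\<lambda>x. G x $ i)) \<and>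
    (\<forall>x. (f has_derivative (\<lambda>h. G x \<bullet> h)) (at x))"
  using assms
proof (induction f)
  case (linear f)
  interpret bounded_linear f by fact
  define c where "c = (\<chi> i. f (axis i 1))"
  have "f h = c \<bullet> h" for h
  proof -
    have "f h = f (\<Sum>i\<in>UNIV. (h $ i) *\<^sub>R axis i 1)"
      using basis_expansion[of h] by (simp add: scalar_mult_eq_scaleR)
    then show ?thesis
      by (simp add: sum scale c_def inner_vec_def mult.commute)
  qed
  then have "f = (\<lambda>h. c \<bullet> h)"
    by (rule ext)
  then have "(f has_derivative (\<lambda>h. c \<bullet> h)) (at x)" for x
    using bounded_linear_imp_has_derivative[OF \<open>bounded_linear f\<close>, of "at x"] by simp
  then show ?case
    by (intro exI[of _ "\<lambda>x. c"]) auto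
next
  case (const c)
  show ?case by (rule exI[of _ "\<lambda>x. 0"]) (auto intro!: derivative_eq_intros)
next
  case (add f g)
  then obtain F G where F: "\<And>i. real_polynomial_function (\<lambda>x. F x $ i)"
    "\<And>x. (f has_derivative (\<lambda>h. F x \<bullet> h)) (at x)"
    and G: "\<And>i. real_polynomial_function (\<lambda>x. G x $ i)"
    "\<And>x. (g has_derivative (\<lambda>h. G x \<bullet> h)) (at x)" by blast
  have "((\<lambda>x. f x + g x) has_derivative (\<lambda>h. (F x + G x) \<bullet> h)) (at x)" for x
    using has_derivative_add[OF F(2) G(2)] by (simp add: inner_left_distrib)
  then show ?case
    using F(1) G(1) by (intro exI[of _ "\<lambda>x. F x + G x"]) auto
next
  case (mult f g)
  then obtain F G where F: "\<And>i. real_polynomial_function (\<lambda>x. F x $ i)"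
    "\<And>x. (f has_derivative (\<lambda>h. F x \<bullet> h)) (at x)"
    and G: "\<And>i. real_polynomial_function (\<lambda>x. G x $ i)"
    "\<And>x. (g has_derivative (\<lambda>h. G x \<bullet> h)) (at x)" by blast
  have "((\<lambda>x. f x * g x) has_derivative (\<lambda>h. (f x *\<^sub>R G x + g x *\<^sub>R F x) \<bullet> h)) (at x)" for x
    using has_derivative_mult[OF F(2) G(2)] by (simp add: inner_left_distrib mult.commute)
  moreover have "real_polynomial_function (\<lambda>x. (f x *\<^sub>R G x + g x *\<^sub>R F x) $ i)" for i
    unfolding vector_add_component vector_scaleR_component real_scaleR_def
    by (intro real_polynomial_function.intros(3,4) F(1) G(1) mult.hyps)
  ultimately show ?case
    by (intro exI[of _ "\<lambda>x. f x *\<^sub>R G x + g x *\<^sub>R F x"] conjI allI)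
qed

lemma has_derivative_imp_gradient_eq:
  assumes "(f has_derivative (\<lambda>h. G \<bullet> h)) (at x)"
  shows "gradient f x = G"
  using frechet_derivative_at[OF assms, symmetric]
  by (simp add: gradient_def vec_eq_iff inner_axis)

lemma real_polynomial_function_gradient:
  assumes "real_polynomial_function f"
  shows "real_polynomial_function (\<lambda>x. gradient f x $ i)"
    and "(f has_derivative (\<lambda>h. gradient f x \<bullet> h)) (at x)"
proof -
  obtain G where "\<And>i. real_polynomial_function (\<lambda>x. G x $ i)"
    "\<And>x. (f has_derivative (\<lambda>h. G x \<bullet> h)) (at x)"
    using real_polynomial_function_has_polynomial_gradient[OF assms] by blast
  moreover from this(2) have "gradient f = G"
    by (intro ext has_derivative_imp_gradient_eq)
  ultimately show "real_polynomial_function (\<lambda>x. gradient f x $ i)"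
    and "(f has_derivative (\<lambda>h. gradient f x \<bullet> h)) (at x)" by auto
qed

lemma gradient_has_derivative_hessian:
  assumes "real_polynomial_function f"
  shows "(gradient f has_derivative (\<lambda>h. hessian f x *v h)) (at x)"
proof -
  \<comment> \<open>The components are polynomials, hence differentiable; the vector is reassembled
    from them along the coordinate axes.\<close>
  have "(\<lambda>x. gradient f x $ i) differentiable (at x)" for i
    using real_polynomial_function_gradient(2)[OF real_polynomial_function_gradient(1)[OF assms]]
    by (auto simp: differentiable_def)
  then have "(\<lambda>x. \<Sum>i\<in>UNIV. (gradient f x $ i) *\<^sub>R axis i (1::real)) differentiable (at x)"
    by (intro differentiable_sum differentiable_scaleR) auto
  moreover have "(\<lambda>x. \<Sum>i\<in>UNIV. (gradient f x $ i) *\<^sub>R axis i 1) = gradient f"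
    using basis_expansion[of "gradient f _"] by (intro ext) (simp add: scalar_mult_eq_scaleR)
  ultimately have "gradient f differentiable (at x)"
    by simp
  then have *: "(gradient f has_derivative frechet_derivative (gradient f) (at x)) (at x)"
    by (simp add: frechet_derivative_works)
  moreover have "frechet_derivative (gradient f) (at x) = (\<lambda>h. hessian f x *v h)"
    unfolding hessian_def using has_derivative_linear[OF *] by (auto simp: matrix_works)
  ultimately show ?thesis by simp
qed

section \<open>Bregman remainders and convexity of SOS-convex polynomials\<close>

text \<open>With the Hessian factored through \<open>H\<close>, its form in the direction
  \<open>x - a\<close> is the sum of the squares of \<open>F k t x\<close>, the entries of the
  transpose of \<open>H\<close> applied to \<open>x - a\<close>. The remainder along the segment and
  the sum of the double antiderivatives have equal second derivatives and equal initial data at 0,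
  so they agree at 1.\<close>

lemma sos_convex_bregman_sum_of_squares:
  fixes f :: "real^'n \<Rightarrow> real"
  assumes "sos_convex f"
  shows "sum_of_squares (\<lambda>x. f x - f a - gradient f a \<bullet> (x - a))"
proof -
  have poly: "real_polynomial_function f"
    using assms by (simp add: sos_convex_def)
  from assms obtain s :: nat and H :: "'n \<Rightarrow> nat \<Rightarrow> real^'n \<Rightarrow> real" where
    H: "\<And>i k. k < s \<Longrightarrow> real_polynomial_function (H i k)"
    and hess: "\<And>x. hessian f x = (\<chi> i j. \<Sum>k<s. H i k x * H j k x)"
    unfolding sos_convex_def sos_matrix_polynomial_def by blast
  define F where "F k t x = (\<Sum>i\<in>UNIV. (x - a) $ i * H i k (a + t *\<^sub>R (x - a)))" for k t x
  have "real_polynomial_function (\<lambda>x. (x - a) $ i)" for i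
    unfolding vector_minus_component
    by (intro real_polynomial_function_diff real_polynomial_function.intros(1,2)
        bounded_linear_vec_nth)
  then have "polynomial_family (F k)" if "k < s" for k
    unfolding F_def using H[OF that]
    by (intro polynomial_family_sum polynomial_family_mult polynomial_family_const
        polynomial_family_segment) auto
  then have "\<exists>S. sum_of_squares S \<and>
      (\<forall>x. \<exists>P P'. double_antiderivative (\<lambda>t. (F k t x)\<^sup>2) P P' \<and> P 1 = S x)" if "k < s" for k
    using that by (intro double_antiderivative_square_sos)
  then obtain S where S: "\<And>k. k < s \<Longrightarrow> sum_of_squares (S k)"
    "\<And>k x. k < s \<Longrightarrow> \<exists>P P'. double_antiderivative (\<lambda>t. (F k t x)\<^sup>2) P P' \<and> P 1 = S k x"
    by metis
  have "f x - f a - gradient f a \<bullet> (x - a) = (\<Sum>k<s. S k x)" for x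
  proof -
    define v where "v = x - a"
    define y where "y t = a + t *\<^sub>R v" for t
    \<comment> \<open>Pairing \<open>P\<close> with \<open>P'\<close> lets a single choice over
      \<open>k\<close> produce both.\<close>
    have "\<forall>k. \<exists>z. k < s \<longrightarrow> double_antiderivative (\<lambda>t. (F k t x)\<^sup>2) (fst z) (snd z) \<and> fst z 1 = S k x"
      using S(2)[of _ x] by force
    from choice[OF this] obtain z where
      z: "\<And>k. k < s \<Longrightarrow> double_antiderivative (\<lambda>t. (F k t x)\<^sup>2) (fst (z k)) (snd (z k))"
      "\<And>k. k < s \<Longrightarrow> fst (z k) 1 = S k x"
      by blast
    define P where "P k = fst (z k)" for k
    define P' where "P' k = snd (z k)" for k
    have P1: "P k 1 = S k x" if "k < s" for k
      using z(2)[OF that] by (simp add: P_def)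
    have "double_antiderivative (\<lambda>t. (F k t x)\<^sup>2) (P k) (P' k)" if "k < s" for k
      using z(1)[OF that] by (simp add: P_def P'_def)
    then have P: "P k 0 = 0" "P' k 0 = 0" "(P k has_real_derivative P' k t) (at t)"
      "(P' k has_real_derivative (F k t x)\<^sup>2) (at t)" if "k < s" for k t
      using that by (auto simp: double_antiderivative_def)
    have dy: "(y has_derivative (\<lambda>h. h *\<^sub>R v)) (at t)" for t
      unfolding y_def by (auto intro!: derivative_eq_intros)
    have d1: "((\<lambda>t. f (y t)) has_real_derivative gradient f (y t) \<bullet> v) (at t)" for t
      by (rule has_derivative_imp_has_field_derivative[OF
          has_derivative_compose[OF dy real_polynomial_function_gradient(2)[OF poly]]]) simp
    have quad: "(hessian f (y t) *v v) \<bullet> v = (\<Sum>k<s. (F k t x)\<^sup>2)" for t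
    proof -
      have "(hessian f (y t) *v v) \<bullet> v
          = (\<Sum>i\<in>UNIV. \<Sum>j\<in>UNIV. \<Sum>k<s. (v $ i * H i k (y t)) * (v $ j * H j k (y t)))"
        unfolding hess inner_vec_def matrix_vector_mult_def
        by (simp add: sum_distrib_right sum_distrib_left mult_ac)
      also have "\<dots> = (\<Sum>i\<in>UNIV. \<Sum>k<s. \<Sum>j\<in>UNIV. (v $ i * H i k (y t)) * (v $ j * H j k (y t)))"
        by (intro sum.cong refl sum.swap)
      also have "\<dots> = (\<Sum>k<s. \<Sum>i\<in>UNIV. \<Sum>j\<in>UNIV. (v $ i * H i k (y t)) * (v $ j * H j k (y t)))"
        by (rule sum.swap)
      also have "\<dots> = (\<Sum>k<s. (F k t x)\<^sup>2)"
        by (simp add: F_def power2_eq_square sum_product v_def y_def)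
      finally show ?thesis .
    qed
    have d2: "((\<lambda>t. gradient f (y t) \<bullet> v) has_real_derivative (\<Sum>k<s. (F k t x)\<^sup>2)) (at t)" for t
    proof -
      have "((\<lambda>t. gradient f (y t) \<bullet> v) has_derivative (\<lambda>h. (hessian f (y t) *v (h *\<^sub>R v)) \<bullet> v)) (at t)"
        by (intro has_derivative_inner_left
            has_derivative_compose[OF dy gradient_has_derivative_hessian[OF poly]])
      then show ?thesis
        by (rule has_derivative_imp_has_field_derivative)
           (simp add: matrix_vector_mult_scaleR quad)
    qed
    \<comment> \<open>\<open>R\<close> is the discrepancy of the two sides along the segment and
      \<open>R'\<close> its derivative. The second derivatives cancel, so \<open>R'\<close> is
      constantly 0, and then so is \<open>R\<close>.\<close>
    define R' where "R' t = gradient f (y t) \<bullet> v - gradient f a \<bullet> v - (\<Sum>k<s. P' k t)" for t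
    define R where "R t = f (y t) - f a - t * (gradient f a \<bullet> v) - (\<Sum>k<s. P k t)" for t
    have "(R' has_real_derivative (\<Sum>k<s. (F k t x)\<^sup>2) - 0 - (\<Sum>k<s. (F k t x)\<^sup>2)) (at t)" for t
      unfolding R'_def by (intro DERIV_diff DERIV_const DERIV_sum d2 P(4)) simp
    then have "R' t = R' 0" for t
      by (intro DERIV_isconst_all) simp
    then have R'0: "R' t = 0" for t
      by (simp add: R'_def y_def P(2))
    have "(R has_real_derivative gradient f (y t) \<bullet> v - 0 - 1 * (gradient f a \<bullet> v) - (\<Sum>k<s. P' k t)) (at t)" for t
      unfolding R_def
      by (intro DERIV_diff DERIV_const DERIV_sum DERIV_cmult_right DERIV_ident d1 P(3)) simp
    then have "R 1 = R 0"
      using R'0 by (intro DERIV_isconst_all) (simp add: R'_def)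
    then show ?thesis
      by (simp add: R_def y_def v_def P(1) P1)
  qed
  moreover have "sum_of_squares (\<lambda>x. \<Sum>k<s. S k x)"
    using S(1) by (intro sum_of_squares_sum) auto
  ultimately show ?thesis by simp
qed

lemma sos_convex_gradient_ineq:
  "sos_convex f \<Longrightarrow> f a + gradient f a \<bullet> (x - a) \<le> f x"
  using sum_of_squares_nonneg[OF sos_convex_bregman_sum_of_squares, of f x a] by simp

text \<open>The tangent inequalities at the intermediate point \<open>z\<close>, taken at
  \<open>x\<close> and \<open>y\<close> and weighted by \<open>1 - t\<close> and \<open>t\<close>,
  add up with cancelling gradient terms.\<close>

lemma sos_convex_imp_convex_on:
  fixes f :: "real^'n \<Rightarrow> real"
  assumes "sos_convex f"
  shows "convex_on UNIV f"
proof (rule convex_onI)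
  fix t :: real and x y :: "real^'n"
  assume t: "0 < t" "t < 1"
  define z where "z = (1 - t) *\<^sub>R x + t *\<^sub>R y"
  have "(1 - t) * (f z + gradient f z \<bullet> (x - z)) + t * (f z + gradient f z \<bullet> (y - z))
      \<le> (1 - t) * f x + t * f y"
    using t sos_convex_gradient_ineq[OF assms, of z]
    by (intro add_mono mult_left_mono) auto
  moreover have "(1 - t) * (f z + gradient f z \<bullet> (x - z)) + t * (f z + gradient f z \<bullet> (y - z))
      = f z + gradient f z \<bullet> ((1 - t) *\<^sub>R (x - z) + t *\<^sub>R (y - z))"
    by (simp add: inner_add_right algebra_simps)
  moreover have "(1 - t) *\<^sub>R (x - z) + t *\<^sub>R (y - z) = 0"
    by (simp add: z_def algebra_simps)
  ultimately show "f ((1 - t) *\<^sub>R x + t *\<^sub>R y) \<le> (1 - t) * f x + t * f y"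
    by (simp add: z_def)
qed simp

section \<open>Degree bounds\<close>

text \<open>The predicate minimised in \<open>poly_degree\<close>. Working with upper bounds avoids
  tracking cancellation of leading terms.\<close>

definition degree_at_most :: "nat \<Rightarrow> (real^'n \<Rightarrow> real) \<Rightarrow> bool" where
  "degree_at_most d f \<longleftrightarrow> (\<exists>c :: ('n \<Rightarrow> nat) \<Rightarrow> real.
     \<forall>x. f x = (\<Sum>\<alpha> | (\<Sum>i\<in>UNIV. \<alpha> i) \<le> d. c \<alpha> * (\<Prod>i\<in>UNIV. (x $ i) ^ \<alpha> i)))"

text \<open>Keeps the sums in \<open>degree_at_most\<close> from taking the default value 0 of an
  infinite sum.\<close>

lemma finite_multi_indices: "finite {\<alpha> :: 'n::finite \<Rightarrow> nat. (\<Sum>i\<in>UNIV. \<alpha> i) \<le> d}"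
proof (rule finite_subset)
  show "{\<alpha> :: 'n \<Rightarrow> nat. (\<Sum>i\<in>UNIV. \<alpha> i) \<le> d} \<subseteq> PiE UNIV (\<lambda>_. {..d})"
  proof
    fix \<alpha> :: "'n \<Rightarrow> nat"
    assume "\<alpha> \<in> {\<alpha>. (\<Sum>i\<in>UNIV. \<alpha> i) \<le> d}"
    moreover have "\<alpha> i \<le> (\<Sum>i\<in>UNIV. \<alpha> i)" for i
      by (rule member_le_sum) auto
    ultimately have "\<alpha> i \<le> d" for i
      using order_trans by blast
    then show "\<alpha> \<in> PiE UNIV (\<lambda>_. {..d})"
      by (simp add: PiE_def extensional_def Pi_def)
  qed
qed (simp add: finite_PiE)

lemma degree_at_most_monomial:
  fixes \<alpha> :: "'n::finite \<Rightarrow> nat"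
  assumes "(\<Sum>i\<in>UNIV. \<alpha> i) \<le> d"
  shows "degree_at_most d (\<lambda>x. c * (\<Prod>i\<in>UNIV. (x $ i) ^ \<alpha> i))"
  unfolding degree_at_most_def
proof (intro exI[of _ "\<lambda>\<beta>. if \<beta> = \<alpha> then c else 0"] allI)
  fix x :: "real^'n"
  have "(\<Sum>\<beta> | (\<Sum>i\<in>UNIV. \<beta> i) \<le> d. (if \<beta> = \<alpha> then c else 0) * (\<Prod>i\<in>UNIV. (x $ i) ^ \<beta> i))
      = (\<Sum>\<beta> | (\<Sum>i\<in>UNIV. \<beta> i) \<le> d. if \<beta> = \<alpha> then c * (\<Prod>i\<in>UNIV. (x $ i) ^ \<alpha> i) else 0)"
    by (intro sum.cong) auto
  then show "c * (\<Prod>i\<in>UNIV. (x $ i) ^ \<alpha> i)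
      = (\<Sum>\<beta> | (\<Sum>i\<in>UNIV. \<beta> i) \<le> d. (if \<beta> = \<alpha> then c else 0) * (\<Prod>i\<in>UNIV. (x $ i) ^ \<beta> i))"
    using assms by (simp add: finite_multi_indices)
qed

lemma degree_at_most_const: "degree_at_most d (\<lambda>x. c)"
  using degree_at_most_monomial[of "\<lambda>_. 0" d c] by simp

lemma degree_at_most_add:
  assumes "degree_at_most d f" "degree_at_most d g"
  shows "degree_at_most d (\<lambda>x. f x + g x)"
proof -
  from assms(1) obtain a where
    a: "\<And>x. f x = (\<Sum>\<alpha> | (\<Sum>i\<in>UNIV. \<alpha> i) \<le> d. a \<alpha> * (\<Prod>i\<in>UNIV. (x $ i) ^ \<alpha> i))"
    unfolding degree_at_most_def by blast
  from assms(2) obtain b where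
    b: "\<And>x. g x = (\<Sum>\<alpha> | (\<Sum>i\<in>UNIV. \<alpha> i) \<le> d. b \<alpha> * (\<Prod>i\<in>UNIV. (x $ i) ^ \<alpha> i))"
    unfolding degree_at_most_def by blast
  show ?thesis
    unfolding degree_at_most_def a b
    by (intro exI[of _ "\<lambda>\<alpha>. a \<alpha> + b \<alpha>"]) (simp add: distrib_right sum.distrib)
qed

lemma degree_at_most_sum:
  assumes "\<And>i. i \<in> I \<Longrightarrow> degree_at_most d (f i)"
  shows "degree_at_most d (\<lambda>x. \<Sum>i\<in>I. f i x)"
  using assms
  by (induction I rule: infinite_finite_induct)
     (auto intro: degree_at_most_add degree_at_most_const)

lemma degree_at_most_mult:
  assumes "degree_at_most d f" "degree_at_most e g"
  shows "degree_at_most (d + e) (\<lambda>x. f x * g x)"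
proof -
  from assms(1) obtain a where
    a: "\<And>x. f x = (\<Sum>\<alpha> | (\<Sum>i\<in>UNIV. \<alpha> i) \<le> d. a \<alpha> * (\<Prod>i\<in>UNIV. (x $ i) ^ \<alpha> i))"
    unfolding degree_at_most_def by blast
  from assms(2) obtain b where
    b: "\<And>x. g x = (\<Sum>\<beta> | (\<Sum>i\<in>UNIV. \<beta> i) \<le> e. b \<beta> * (\<Prod>i\<in>UNIV. (x $ i) ^ \<beta> i))"
    unfolding degree_at_most_def by blast
  have fg: "f x * g x = (\<Sum>\<alpha> | (\<Sum>i\<in>UNIV. \<alpha> i) \<le> d. \<Sum>\<beta> | (\<Sum>i\<in>UNIV. \<beta> i) \<le> e.
      (a \<alpha> * b \<beta>) * (\<Prod>i\<in>UNIV. (x $ i) ^ (\<alpha> i + \<beta> i)))" for x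
    unfolding a b sum_product power_add prod.distrib by (intro sum.cong refl) (simp add: mult_ac)
  show ?thesis
    unfolding fg
    by (intro degree_at_most_sum degree_at_most_monomial) (simp add: sum.distrib add_mono)
qed

lemma degree_at_most_scale:
  "degree_at_most d f \<Longrightarrow> degree_at_most d (\<lambda>x. c * f x)"
  using degree_at_most_mult[OF degree_at_most_const[of 0 c]] by simp

text \<open>Raising the bound amounts to multiplying by 1, seen as a polynomial of degree at most
  \<open>e - d\<close>.\<close>

lemma degree_at_most_mono:
  assumes "degree_at_most d f" "d \<le> e"
  shows "degree_at_most e f"
  using degree_at_most_mult[OF assms(1) degree_at_most_const[of "e - d" 1]] assms(2) by simp

text \<open>Supplies the existence that makes the \<open>LEAST\<close> in \<open>poly_degree\<close>
  meaningful.\<close>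

lemma real_polynomial_function_degree_at_most:
  fixes f :: "real^'n \<Rightarrow> real"
  assumes "real_polynomial_function f"
  shows "\<exists>d. degree_at_most d f"
  using assms
proof (induction f)
  case (linear f)
  interpret bounded_linear f by fact
  have "degree_at_most 1 (\<lambda>x. f (axis i 1) * (x $ i))" for i
    using degree_at_most_monomial[of "\<lambda>k. if k = i then 1 else 0" 1 "f (axis i 1)"]
    by (simp add: if_distrib[where f="\<lambda>k. _ ^ k"] cong: if_cong)
  then have "degree_at_most 1 (\<lambda>x. \<Sum>i\<in>UNIV. f (axis i 1) * (x $ i))"
    by (intro degree_at_most_sum)
  moreover have "(\<lambda>x. \<Sum>i\<in>UNIV. f (axis i 1) * (x $ i)) = f"
  proof
    fix x
    have "f x = f (\<Sum>i\<in>UNIV. (x $ i) *\<^sub>R axis i 1)"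
      using basis_expansion[of x] by (simp add: scalar_mult_eq_scaleR)
    then show "(\<Sum>i\<in>UNIV. f (axis i 1) * (x $ i)) = f x"
      by (simp add: sum scale mult.commute)
  qed
  ultimately show ?case by auto
next
  case (const c)
  show ?case using degree_at_most_const by blast
next
  case (add f g)
  then obtain d e where "degree_at_most d f" "degree_at_most e g" by blast
  then have "degree_at_most (d + e) (\<lambda>x. f x + g x)"
    by (intro degree_at_most_add) (auto elim: degree_at_most_mono)
  then show ?case ..
next
  case (mult f g)
  then show ?case using degree_at_most_mult by blast
qed

lemma poly_degree_le: "degree_at_most d f \<Longrightarrow> poly_degree f \<le> d"
  unfolding poly_degree_def degree_at_most_def by (rule Least_le)

lemma degree_at_most_poly_degree:
  assumes "real_polynomial_function f"
  shows "degree_at_most (poly_degree f) f"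
  using real_polynomial_function_degree_at_most[OF assms]
  unfolding poly_degree_def degree_at_most_def by (rule LeastI_ex)

section \<open>Separation and first-order optimality\<close>

text \<open>A Gordan-type alternative for convex functions. A hyperplane separates the negative
  orthant \<open>S\<close> from \<open>T\<close>, the upward closure of the image of
  \<open>F\<close> under \<open>h\<close>. Upward closure makes \<open>T\<close> convex and forces
  the normal to be nonnegative, so its normalisation gives the weights.\<close>

lemma convex_theorem_of_alternative:
  fixes h :: "'r::finite \<Rightarrow> real^'n \<Rightarrow> real"
  assumes "convex F" "F \<noteq> {}"
    and h: "\<And>j. convex_on F (h j)"
    and no_neg: "\<And>x. x \<in> F \<Longrightarrow> \<exists>j. 0 \<le> h j x"
  shows "\<exists>\<delta>\<in>unit_simplex. \<forall>x\<in>F. 0 \<le> (\<Sum>j\<in>UNIV. (\<delta>::real^'r) $ j * h j x)"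
proof -
  define S where "S = {y::real^'r. \<forall>j. y $ j < 0}"
  define T where "T = {y::real^'r. \<exists>x\<in>F. \<forall>j. h j x \<le> y $ j}"
  have "convex S"
    unfolding S_def convex_def by (auto intro: convex_bound_lt)
  moreover have "convex T"
    unfolding convex_alt
  proof (intro ballI allI impI)
    fix y z :: "real^'r" and u :: real
    assume "y \<in> T" "z \<in> T" and u: "0 \<le> u \<and> u \<le> 1"
    then obtain a b where ab: "a \<in> F" "b \<in> F" "\<And>j. h j a \<le> y $ j" "\<And>j. h j b \<le> z $ j"
      unfolding T_def by auto
    have "h j ((1 - u) *\<^sub>R a + u *\<^sub>R b) \<le> ((1 - u) *\<^sub>R y + u *\<^sub>R z) $ j" for j
    proof -
      have "h j ((1 - u) *\<^sub>R a + u *\<^sub>R b) \<le> (1 - u) * h j a + u * h j b"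
        using convex_onD[OF h] u ab by auto
      also have "\<dots> \<le> (1 - u) * y $ j + u * z $ j"
        using u ab by (intro add_mono mult_left_mono) auto
      finally show ?thesis by simp
    qed
    moreover have "(1 - u) *\<^sub>R a + u *\<^sub>R b \<in> F"
      using \<open>convex F\<close> u ab by (auto simp: convex_alt)
    ultimately show "(1 - u) *\<^sub>R y + u *\<^sub>R z \<in> T"
      unfolding T_def by blast
  qed
  moreover have "(\<chi> j. -1) \<in> S"
    by (simp add: S_def)
  moreover have in_T: "(\<chi> j. h j x) + w \<in> T" if "x \<in> F" "\<And>j. 0 \<le> w $ j" for x w
    using that by (auto simp: T_def intro!: bexI[of _ x])
  obtain x0 where x0: "x0 \<in> F"
    using \<open>F \<noteq> {}\<close> by blast
  moreover from in_T[OF x0, of 0] have "T \<noteq> {}"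
    by auto
  moreover have "S \<inter> T = {}"
    using no_neg unfolding S_def T_def by (force dest: order.strict_trans1)
  ultimately obtain a b where "a \<noteq> 0" and a: "\<And>y. y \<in> S \<Longrightarrow> a \<bullet> y \<le> b" "\<And>y. y \<in> T \<Longrightarrow> b \<le> a \<bullet> y"
    using separating_hyperplane_sets[of S T] by blast
  have b: "0 \<le> b"
  proof (rule ccontr)
    assume "\<not> 0 \<le> b"
    define s where "s = (\<Sum>j\<in>UNIV. a $ j)"
    \<comment> \<open>Points of \<open>S\<close> come arbitrarily close to 0. This \<open>e\<close>
      gives the vector with all entries \<open>- e\<close> a product with \<open>a\<close> of at
      least \<open>b / 2\<close>, which exceeds a negative \<open>b\<close>.\<close>
    define e where "e = - b / (2 * (\<bar>s\<bar> + 1))"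
    have "0 < e"
      unfolding e_def using \<open>\<not> 0 \<le> b\<close> by (intro divide_pos_pos) auto
    then have "a \<bullet> (\<chi> j. - e) \<le> b"
      by (intro a(1)) (simp add: S_def)
    then have "- (e * s) \<le> b"
      by (simp add: inner_vec_def s_def sum_distrib_left sum_negf mult.commute)
    moreover have "e * s \<le> e * (\<bar>s\<bar> + 1)"
      using \<open>0 < e\<close> by (intro mult_left_mono) auto
    moreover have "e * (\<bar>s\<bar> + 1) = - b / 2"
      by (simp add: e_def field_simps)
    ultimately show False
      using \<open>\<not> 0 \<le> b\<close> by linarith
  qed
  have nonneg: "0 \<le> a $ j" for j
  proof (rule ccontr)
    assume neg: "\<not> 0 \<le> a $ j"
    define c where "c = a \<bullet> (\<chi> j. h j x0)"
    \<comment> \<open>Moving up by \<open>t\<close> in coordinate \<open>j\<close> stays in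
      \<open>T\<close> but lowers the product with \<open>a\<close> to
      \<open>c - (\<bar>c\<bar> + 1)\<close>, which is negative.\<close>
    define t where "t = (\<bar>c\<bar> + 1) / (- a $ j)"
    have "0 \<le> t"
      unfolding t_def using neg by (intro divide_nonneg_pos) auto
    then have "b \<le> a \<bullet> ((\<chi> j. h j x0) + axis j t)"
      by (intro a(2) in_T x0) (simp add: axis_def)
    also have "\<dots> = c + a $ j * t"
      by (simp add: inner_add_right inner_axis c_def)
    also have "a $ j * t = - (\<bar>c\<bar> + 1)"
      using neg by (simp add: t_def field_simps)
    finally show False
      using b by linarith
  qed
  define s where "s = (\<Sum>j\<in>UNIV. a $ j)"
  obtain j where "a $ j \<noteq> 0"
    using \<open>a \<noteq> 0\<close> by (auto simp: vec_eq_iff)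
  then have "0 < s"
    unfolding s_def using nonneg by (intro sum_pos2[of _ j]) (auto simp: less_le)
  have "0 \<le> (\<Sum>j\<in>UNIV. (a /\<^sub>R s) $ j * h j x)" if "x \<in> F" for x
  proof -
    have "0 \<le> a \<bullet> (\<chi> j. h j x)"
      using b a(2)[OF in_T[OF that, of 0]] by simp
    then have "0 \<le> inverse s * (\<Sum>j\<in>UNIV. a $ j * h j x)"
      using \<open>0 < s\<close> by (simp add: inner_vec_def)
    then show ?thesis
      by (simp add: sum_distrib_left mult.assoc)
  qed
  moreover have "a /\<^sub>R s \<in> unit_simplex"
    using nonneg \<open>0 < s\<close>
    by (simp add: unit_simplex_def nonneg_orthant_def s_def[symmetric] flip: sum_distrib_left)
  ultimately show ?thesis by blast
qed

text \<open>A negative directional derivative towards some \<open>y\<close> in \<open>C\<close>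
  would make \<open>f\<close> decrease on a short initial piece of the segment, which lies in
  \<open>C\<close>.\<close>

lemma neg_gradient_in_normal_cone:
  fixes f :: "real^'n \<Rightarrow> real"
  assumes "convex C" "a \<in> C"
    and deriv: "(f has_derivative (\<lambda>h. G \<bullet> h)) (at a)"
    and min: "\<And>y. y \<in> C \<Longrightarrow> f a \<le> f y"
  shows "- G \<in> normal_cone C a"
  unfolding normal_cone_def
proof (intro CollectI ballI)
  fix y assume y: "y \<in> C"
  define \<phi> where "\<phi> t = f (a + t *\<^sub>R (y - a))" for t
  have "((\<lambda>t. a + t *\<^sub>R (y - a)) has_derivative (\<lambda>h. h *\<^sub>R (y - a))) (at 0)"
    by (auto intro!: derivative_eq_intros)
  from has_derivative_compose[OF this, of f "\<lambda>h. G \<bullet> h"] deriv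
  have "(\<phi> has_derivative (\<lambda>h. G \<bullet> (h *\<^sub>R (y - a)))) (at 0)"
    by (simp add: \<phi>_def[abs_def])
  then have D: "(\<phi> has_real_derivative G \<bullet> (y - a)) (at 0)"
    by (rule has_derivative_imp_has_field_derivative) simp
  have "0 \<le> G \<bullet> (y - a)"
  proof (rule ccontr)
    assume "\<not> 0 \<le> G \<bullet> (y - a)"
    then obtain e where e: "0 < e" "\<And>h. 0 < h \<Longrightarrow> h < e \<Longrightarrow> \<phi> (0 + h) < \<phi> 0"
      using DERIV_neg_dec_right[OF D] by (auto simp: not_le)
    define t where "t = min (e / 2) 1"
    have t: "0 < t" "t < e" "t \<le> 1"
      using e(1) by (auto simp: t_def)
    have "a + t *\<^sub>R (y - a) = (1 - t) *\<^sub>R a + t *\<^sub>R y"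
      by (simp add: algebra_simps)
    also have "\<dots> \<in> C"
      using assms(1,2) y t by (auto simp: convex_alt)
    finally have "\<phi> 0 \<le> \<phi> t"
      using min by (simp add: \<phi>_def)
    then show False
      using e(2)[of t] t by simp
  qed
  then show "- G \<bullet> (y - a) \<le> 0" by simp
qed

section \<open>Strong duality with attainment for the fractional program\<close>

theorem theorem4p8:
  fixes p :: "'r::finite \<Rightarrow> real^'n \<Rightarrow> real"
    and g :: "'m::finite \<Rightarrow> real^'n \<Rightarrow> real"
    and q :: "real^'n \<Rightarrow> real"
    and d :: nat
    and xstar :: "real^'n"
  assumes p_poly: "\<And>j. real_polynomial_function (p j)"
    and g_poly: "\<And>i. real_polynomial_function (g i)"
    and q_poly: "real_polynomial_function q"
    and p_sos_convex: "\<And>j. sos_convex (p j)"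
    and g_sos_convex: "\<And>i. sos_convex (g i)"
    and neg_q_sos_convex: "sos_convex (\<lambda>x. - q x)"
    and F_nonempty: "feasible_set g \<noteq> {}"
    and p_nonneg: "\<And>j x. x \<in> feasible_set g \<Longrightarrow> 0 \<le> p j x"
    and q_pos: "\<And>x. x \<in> feasible_set g \<Longrightarrow> 0 < q x"
    and d_def: "d = (LEAST e. even e \<and>
      Max ({poly_degree q} \<union> range (\<lambda>j. poly_degree (p j)) \<union> range (\<lambda>i. poly_degree (g i))) \<le> e)"
    and xstar_optimal: "is_arg_min (primal_objective p q) (\<lambda>x. x \<in> feasible_set g) xstar"
    and normal_cone_cond: "normal_cone_condition g xstar"
  shows "primal_value p g q = dual_value d p g q
    \<and> (\<exists>x\<in>feasible_set g. ereal (primal_objective p q x) = primal_value p g q)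
    \<and> (\<exists>\<mu>\<in>dual_feasible_values d p g q. ereal \<mu> = dual_value d p g q)"
proof -
  define F where "F = feasible_set g"
  define \<mu> where "\<mu> = primal_objective p q xstar"
  have xF: "xstar \<in> F"
    using xstar_optimal by (simp add: is_arg_min_def F_def)
  have opt: "\<mu> \<le> primal_objective p q y" if "y \<in> F" for y
    using xstar_optimal that by (auto simp: is_arg_min_def F_def \<mu>_def not_less)
  have q: "0 < q x" if "x \<in> F" for x
    using q_pos that by (simp add: F_def)
  have ratio_le: "p j xstar \<le> \<mu> * q xstar" for j
  proof -
    have "p j xstar / q xstar \<le> \<mu>"
      unfolding \<mu>_def primal_objective_def by (intro Max_ge) auto
    then show ?thesis
      using q[OF xF] by (simp add: field_simps)
  qed
  \<comment> \<open>The sign matters because only \<open>- q\<close> is SOS-convex: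
    \<open>- \<mu> * q\<close> then inherits convexity and later a sum-of-squares remainder.
    \<open>undefined\<close> serves as an arbitrary index.\<close>
  have "0 \<le> \<mu>"
  proof -
    have "0 \<le> \<mu> * q xstar"
      using p_nonneg[of xstar undefined] ratio_le[of undefined] xF by (simp add: F_def)
    then show ?thesis
      using q[OF xF] by (simp add: zero_le_mult_iff)
  qed
  have convex_F: "convex F"
  proof -
    have "convex {x. g i x \<le> 0}" for i
      unfolding convex_alt
    proof clarify
      fix x y and u :: real
      assume *: "g i x \<le> 0" "g i y \<le> 0" "0 \<le> u" "u \<le> 1"
      have "g i ((1 - u) *\<^sub>R x + u *\<^sub>R y) \<le> (1 - u) * g i x + u * g i y"
        using convex_onD[OF sos_convex_imp_convex_on[OF g_sos_convex[of i]]] * by simp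
      also have "\<dots> \<le> 0"
        using * by (intro add_nonpos_nonpos mult_nonneg_nonpos) auto
      finally show "g i ((1 - u) *\<^sub>R x + u *\<^sub>R y) \<le> 0" .
    qed
    then have "convex (\<Inter>i. {x. g i x \<le> 0})"
      by (intro convex_INT) auto
    moreover have "F = (\<Inter>i. {x. g i x \<le> 0})"
      by (auto simp: F_def feasible_set_def)
    ultimately show ?thesis by simp
  qed

  \<comment> \<open>Clearing the positive denominator: a ratio is at least \<mu> exactly when its
    \<open>h j\<close> is nonnegative on \<open>F\<close>.\<close>
  define h where "h j x = p j x - \<mu> * q x" for j x
  have h_convex: "convex_on F (h j)" for j
  proof -
    have "convex_on F (\<lambda>x. p j x + \<mu> * (- q x))"
      by (intro convex_on_add convex_on_cmul \<open>0 \<le> \<mu>\<close>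
          convex_on_subset[OF sos_convex_imp_convex_on subset_UNIV]
          p_sos_convex neg_q_sos_convex convex_F)
    then show ?thesis
      by (simp add: h_def[abs_def])
  qed
  have h_nonneg: "\<exists>j. 0 \<le> h j x" if "x \<in> F" for x
  proof -
    have "primal_objective p q x \<in> range (\<lambda>j. p j x / q x)"
      unfolding primal_objective_def by (rule Max_in) auto
    then obtain j where "primal_objective p q x = p j x / q x" by blast
    then have "\<mu> \<le> p j x / q x"
      using opt[OF that] by simp
    then show ?thesis
      using q[OF that] by (intro exI[of _ j]) (simp add: h_def pos_le_divide_eq)
  qed
  obtain \<delta> :: "real^'r" where \<delta>: "\<delta> \<in> unit_simplex"
    and \<delta>_nonneg: "\<And>x. x \<in> F \<Longrightarrow> 0 \<le> (\<Sum>j\<in>UNIV. \<delta> $ j * h j x)"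
    using convex_theorem_of_alternative[OF convex_F _ h_convex h_nonneg] xF by blast
  have \<delta>0: "0 \<le> \<delta> $ j" for j
    using \<delta> by (simp add: unit_simplex_def nonneg_orthant_def)
  have \<delta>1: "(\<Sum>j\<in>UNIV. \<delta> $ j) = 1"
    using \<delta> by (simp add: unit_simplex_def)
  define \<phi> where "\<phi> x = (\<Sum>j\<in>UNIV. \<delta> $ j * p j x) - \<mu> * q x" for x
  have \<phi>_h: "(\<Sum>j\<in>UNIV. \<delta> $ j * h j x) = \<phi> x" for x
    using \<delta>1 by (simp add: h_def \<phi>_def right_diff_distrib sum_subtractf flip: sum_distrib_right)
  \<comment> \<open>Every \<open>h j\<close> is at most 0 at \<open>xstar\<close>, while
    \<open>\<phi>\<close> is nonnegative on \<open>F\<close>. Hence \<open>xstar\<close> minimises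
    \<open>\<phi>\<close> over \<open>F\<close> with value 0.\<close>
  have "\<phi> xstar \<le> 0"
    unfolding \<phi>_h[symmetric] using ratio_le \<delta>0
    by (intro sum_nonpos mult_nonneg_nonpos) (auto simp: h_def)
  then have \<phi>0: "\<phi> xstar = 0"
    using \<delta>_nonneg[OF xF] by (simp add: \<phi>_h)
  \<comment> \<open>The gradient of \<open>\<phi>\<close> at \<open>xstar\<close>, expressed through
    the gradient of \<open>- q\<close> to match the remainder of that SOS-convex polynomial.\<close>
  define G where "G = (\<Sum>j\<in>UNIV. \<delta> $ j *\<^sub>R gradient (p j) xstar) + \<mu> *\<^sub>R gradient (\<lambda>x. - q x) xstar"
  have neg_q_poly: "real_polynomial_function (\<lambda>x. - q x)"
    using q_poly by auto
  have "((\<lambda>x. (\<Sum>j\<in>UNIV. \<delta> $ j * p j x) + \<mu> * (- q x)) has_derivative (\<lambda>h. G \<bullet> h)) (at xstar)"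
    unfolding G_def inner_left_distrib inner_sum_left inner_scaleR_left
    by (intro has_derivative_add has_derivative_sum has_derivative_mult_right
        real_polynomial_function_gradient(2) p_poly neg_q_poly)
  then have "(\<phi> has_derivative (\<lambda>h. G \<bullet> h)) (at xstar)"
    by (simp add: \<phi>_def[abs_def])
  from neg_gradient_in_normal_cone[OF convex_F xF this]
  have "- G \<in> normal_cone (feasible_set g) xstar"
    using \<delta>_nonneg by (simp add: \<phi>_h \<phi>0 F_def)
  \<comment> \<open>The normal cone condition turns stationarity into multipliers with complementary
    slackness.\<close>
  then obtain l :: "real^'m" where l: "l \<in> nonneg_orthant" "(\<Sum>i\<in>UNIV. l $ i * g i xstar) = 0"
    and G: "- G = (\<Sum>i\<in>UNIV. l $ i *\<^sub>R gradient (g i) xstar)"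
    using normal_cone_cond unfolding normal_cone_condition_def by auto
  have l0: "0 \<le> l $ i" for i
    using l(1) by (simp add: nonneg_orthant_def)

  define \<sigma> where "\<sigma> x = (\<Sum>j\<in>UNIV. \<delta> $ j * p j x) + (\<Sum>i\<in>UNIV. l $ i * g i x) - \<mu> * q x" for x
  define B where "B f x = f x - f xstar - gradient f xstar \<bullet> (x - xstar)" for f x
  \<comment> \<open>\<open>\<sigma>\<close> and its gradient vanish at \<open>xstar\<close>, so \<open>\<sigma>\<close> equals its own Bregman remainder.\<close>
  have \<sigma>_eq: "\<sigma> x = (\<Sum>j\<in>UNIV. \<delta> $ j * B (p j) x) + (\<Sum>i\<in>UNIV. l $ i * B (g i) x) + \<mu> * B (\<lambda>x. - q x) x" for x
  proof -
    have "(G + (\<Sum>i\<in>UNIV. l $ i *\<^sub>R gradient (g i) xstar)) \<bullet> (x - xstar) = 0"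
      using G by (metis add.right_inverse inner_zero_left)
    then show ?thesis
      using l(2) \<phi>0
      by (simp add: \<sigma>_def B_def \<phi>_def G_def right_diff_distrib sum_subtractf inner_left_distrib
          inner_sum_left)
  qed
  have B_sos: "sum_of_squares (B f)" if "sos_convex f" for f
    unfolding B_def using sos_convex_bregman_sum_of_squares[OF that] .
  have "sum_of_squares \<sigma>"
    unfolding \<sigma>_eq[abs_def]
    by (intro sum_of_squares_add sum_of_squares_sum sum_of_squares_scale B_sos finite
        \<delta>0 l0 \<open>0 \<le> \<mu>\<close> p_sos_convex g_sos_convex neg_q_sos_convex)
  moreover have "poly_degree \<sigma> \<le> d"
  proof -
    define M where "M = Max ({poly_degree q} \<union> range (\<lambda>j. poly_degree (p j)) \<union> range (\<lambda>i. poly_degree (g i)))"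
    \<comment> \<open>A witness that even upper bounds exist, so the \<open>LEAST\<close> defining
      \<open>d\<close> is itself such a bound.\<close>
    have "even (2 * M) \<and> M \<le> 2 * M" by simp
    then have "M \<le> d"
      unfolding d_def M_def[symmetric] by (rule LeastI2) simp
    moreover have "poly_degree q \<le> M" "poly_degree (p j) \<le> M" "poly_degree (g i) \<le> M" for i j
      unfolding M_def by (rule Max_ge; simp)+
    ultimately have deg: "degree_at_most d q" "degree_at_most d (p j)" "degree_at_most d (g i)" for i j
      using degree_at_most_mono[OF degree_at_most_poly_degree] p_poly g_poly q_poly
      by (meson order_trans)+
    have "degree_at_most d (\<lambda>x. (\<Sum>j\<in>UNIV. \<delta> $ j * p j x) + (\<Sum>i\<in>UNIV. l $ i * g i x) + (- \<mu>) * q x)"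
      by (intro degree_at_most_add degree_at_most_sum degree_at_most_scale deg)
    then have "degree_at_most d \<sigma>"
      by (simp add: \<sigma>_def[abs_def])
    then show ?thesis by (rule poly_degree_le)
  qed
  ultimately have "\<sigma> \<in> sos_of_degree_at_most d"
    by (simp add: sos_of_degree_at_most_def)
  then have dual_\<mu>: "\<mu> \<in> dual_feasible_values d p g q"
    unfolding dual_feasible_values_def using \<delta> l(1) unfolding \<sigma>_def[abs_def] by blast

  \<comment> \<open>Weak duality by evaluating the certificate at \<open>xstar\<close> alone: the
    constraint terms are at most 0 and the weighted \<open>p j\<close> at most
    \<open>\<mu> * q xstar\<close>; dividing by \<open>q xstar > 0\<close> finishes.\<close>
  have weak: "\<nu> \<le> \<mu>" if "\<nu> \<in> dual_feasible_values d p g q" for \<nu>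
  proof -
    from that obtain \<epsilon> :: "real^'r" and k :: "real^'m" where \<epsilon>: "\<epsilon> \<in> unit_simplex"
      and k: "k \<in> nonneg_orthant"
      and sos: "sum_of_squares (\<lambda>x. (\<Sum>j\<in>UNIV. \<epsilon> $ j * p j x) + (\<Sum>i\<in>UNIV. k $ i * g i x) - \<nu> * q x)"
      unfolding dual_feasible_values_def sos_of_degree_at_most_def by auto
    have "(\<Sum>i\<in>UNIV. k $ i * g i xstar) \<le> 0"
      using k xF by (intro sum_nonpos mult_nonneg_nonpos)
        (auto simp: nonneg_orthant_def F_def feasible_set_def)
    moreover have "(\<Sum>j\<in>UNIV. \<epsilon> $ j * p j xstar) \<le> (\<Sum>j\<in>UNIV. \<epsilon> $ j * (\<mu> * q xstar))"
      using \<epsilon> ratio_le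
      by (intro sum_mono mult_left_mono) (auto simp: unit_simplex_def nonneg_orthant_def)
    moreover have "(\<Sum>j\<in>UNIV. \<epsilon> $ j * (\<mu> * q xstar)) = \<mu> * q xstar"
      using \<epsilon> by (simp add: unit_simplex_def flip: sum_distrib_right)
    ultimately have "\<nu> * q xstar \<le> \<mu> * q xstar"
      using sum_of_squares_nonneg[OF sos, of xstar] by linarith
    then show ?thesis
      using q[OF xF] by simp
  qed
  have "primal_value p g q = ereal \<mu>"
    unfolding primal_value_def F_def[symmetric] using xF opt
    by (intro antisym INF_lower2[OF xF] INF_greatest) (auto simp: \<mu>_def)
  moreover have "dual_value d p g q = ereal \<mu>"
    unfolding dual_value_def using weak
    by (intro antisym SUP_upper2[OF dual_\<mu>] SUP_least) auto
  ultimately show ?thesis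
    using xF dual_\<mu> unfolding F_def \<mu>_def by auto
qed

end
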